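(* There exist a commutative algebra $\mathcal{A}$ of $2\times 2$ matrices over $\mathbb{R}$ (with the usual matrix operations) and a norm $|\cdot|$ on $\mathcal{A}$ such that $|A^2| \le |A|^2$ for all $A \in \mathcal{A}$ and $|A^3| > |A|^3$ for some $A \in \mathcal{A}$.
   Context: A norm on a real algebra $\mathcal{A}$ means a norm on the underlying real vector space (positive definite, absolutely homogeneous, satisfying the triangle inequality); it is not required to be submultiplicative. *)

theory Defs
  imports "HOL-Analysis.Analysis"
begin

text \<open>No unit is demanded of the subalgebra.\<close>

definition commutative_matrix_algebra :: "(real ^ 'n ^ 'n) set \<Rightarrow> bool" where
  "commutative_matrix_algebra \<A> \<longleftrightarrow>
     subspace \<A> \<and>
     (\<forall>A\<in>\<A>. \<forall>B\<in>\<A>. A ** B \<in> \<A>) \<and>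
     (\<forall>A\<in>\<A>. \<forall>B\<in>\<A>. A ** B = B ** A)"

text \<open>A norm on a linear subspace, given by a function whose values outside the subspace are
  irrelevant. No submultiplicativity is required.\<close>

definition norm_on_subspace :: "'a::real_vector set \<Rightarrow> ('a \<Rightarrow> real) \<Rightarrow> bool" where
  "norm_on_subspace V \<nu> \<longleftrightarrow>
     (\<forall>x\<in>V. 0 \<le> \<nu> x) \<and>
     (\<forall>x\<in>V. \<nu> x = 0 \<longleftrightarrow> x = 0) \<and>
     (\<forall>c. \<forall>x\<in>V. \<nu> (c *\<^sub>R x) = \<bar>c\<bar> * \<nu> x) \<and>
     (\<forall>x\<in>V. \<forall>y\<in>V. \<nu> (x + y) \<le> \<nu> x + \<nu> y)"

end

theory Submission
  imports Defs
begin

text \<open>The algebra consists of the matrices with diagonal \<open>(a, a)\<close>, upper right entry \<open>b\<close> and lower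
  left entry \<open>0\<close>, that is, of the dual numbers \<open>a + b\<epsilon>\<close> with \<open>\<epsilon>\<^sup>2 = 0\<close>. There squaring sends
  \<open>(a, b)\<close> to \<open>(a\<^sup>2, 2ab)\<close> and cubing sends it to \<open>(a\<^sup>3, 3a\<^sup>2b)\<close>. By homogeneity the task is to find
  a symmetric convex body that is mapped into itself by squaring but not by cubing. For a body
  \<open>{(a, b). \<bar>b\<bar> \<le> f \<bar>a\<bar>, \<bar>a\<bar> \<le> p}\<close> with \<open>f\<close> concave and decreasing, this asks for \<open>p \<le> 1\<close>,
  for \<open>2a f(a) \<le> f(a\<^sup>2)\<close> on \<open>[0, p]\<close>, and for \<open>3a\<^sup>2 f(a) > f(a\<^sup>3)\<close> at some \<open>a\<close>.

  Take \<open>p = 7/10\<close> and let \<open>f\<close> be the minimum of a constant \<open>c\<close> and the linear function \<open>l\<close> with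
  \<open>l(p) = 1\<close> and \<open>l(p\<^sup>2) = 2p\<close>, so that the squaring condition for \<open>l\<close> is sharp at the corner
  \<open>(p, 1)\<close>. The cube of this corner is \<open>(p\<^sup>3, 3p\<^sup>2)\<close> and leaves the body as soon as
  \<open>c < 3p\<^sup>2 = 147/100\<close>. The body remains closed under squaring if \<open>2a l(a) \<le> c\<close> for all \<open>a\<close>, which
  means \<open>c \<ge> 343/240 = 1.429...\<close>. The two bounds leave room for \<open>c = 100/69\<close>. The norm below is
  the gauge of this octagon: the maximum of the gauges of the strips \<open>\<bar>a\<bar> \<le> p\<close> and \<open>\<bar>b\<bar> \<le> c\<close> and
  of the rhombus \<open>\<bar>b\<bar> \<le> l \<bar>a\<bar>\<close>.\<close>

definition octagon_gauge :: "real \<Rightarrow> real \<Rightarrow> real" where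
  "octagon_gauge a b =
     max (10/7 * \<bar>a\<bar>) (max (69/100 * \<bar>b\<bar>) (40/49 * \<bar>a\<bar> + 3/7 * \<bar>b\<bar>))"

lemma octagon_gauge_nonneg: "0 \<le> octagon_gauge a b"
  by (simp add: octagon_gauge_def max_def)

lemma octagon_gauge_eq_0_iff: "octagon_gauge a b = 0 \<longleftrightarrow> a = 0 \<and> b = 0"
  by (auto simp: octagon_gauge_def max_def split: if_splits)

lemma octagon_gauge_scale: "octagon_gauge (c * a) (c * b) = \<bar>c\<bar> * octagon_gauge a b"
  by (simp add: octagon_gauge_def max_mult_distrib_left abs_mult algebra_simps)

lemma octagon_gauge_le_iff:
  "octagon_gauge a b \<le> r \<longleftrightarrow>
     10/7 * \<bar>a\<bar> \<le> r \<and> 69/100 * \<bar>b\<bar> \<le> r \<and> 40/49 * \<bar>a\<bar> + 3/7 * \<bar>b\<bar> \<le> r"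
  unfolding octagon_gauge_def by (simp only: max.bounded_iff)

lemmas octagon_gauge_ge = octagon_gauge_le_iff[THEN iffD1, OF order_refl]

lemma octagon_gauge_triangle:
  "octagon_gauge (a + a') (b + b') \<le> octagon_gauge a b + octagon_gauge a' b'"
proof -
  have "\<bar>a + a'\<bar> \<le> \<bar>a\<bar> + \<bar>a'\<bar>" "\<bar>b + b'\<bar> \<le> \<bar>b\<bar> + \<bar>b'\<bar>"
    by (rule abs_triangle_ineq)+
  with octagon_gauge_ge[of a b] octagon_gauge_ge[of a' b'] show ?thesis
    unfolding octagon_gauge_le_iff by argo
qed

text \<open>The gauge of a dual number bounds the gauge of its square. Each of the three gauges of the
  square is bounded for its own reason: the strip \<open>\<bar>a\<bar> \<le> 7/10\<close> lies in \<open>\<bar>a\<bar> \<le> 1\<close>; the product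
  \<open>2ab\<close> is controlled by the arithmetic-geometric mean inequality applied to the rhombus gauge; and
  the rhombus gauge of the square is a quadratic in the first and third gauges \<open>u\<close>, \<open>v\<close> whose
  largest value for \<open>u, v \<le> N\<close> is attained at the corner \<open>u = v = N\<close>, where it equals \<open>N\<^sup>2\<close>.\<close>

lemma octagon_gauge_square_le: "octagon_gauge (a\<^sup>2) (2 * a * b) \<le> (octagon_gauge a b)\<^sup>2"
proof -
  define N u v where "N = octagon_gauge a b" and "u = 10/7 * \<bar>a\<bar>"
    and "v = 40/49 * \<bar>a\<bar> + 3/7 * \<bar>b\<bar>"
  have uN: "u \<le> N" and vN: "v \<le> N" and u0: "0 \<le> u" and v0: "0 \<le> v"
    using octagon_gauge_ge[of a b] by (simp_all add: N_def u_def v_def)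
  have abs_a: "\<bar>a\<bar> = 7/10 * u" and abs_b: "\<bar>b\<bar> = (7 * v - 4 * u) / 3"
    by (simp_all add: u_def v_def)
  have sq: "\<bar>a\<^sup>2\<bar> = \<bar>a\<bar>\<^sup>2" and prod: "\<bar>2 * a * b\<bar> = 2 * \<bar>a\<bar> * \<bar>b\<bar>"
    by (simp_all add: abs_mult)
  have strip_a: "10/7 * \<bar>a\<^sup>2\<bar> \<le> N\<^sup>2"
  proof -
    have "10/7 * \<bar>a\<^sup>2\<bar> \<le> u\<^sup>2"
      by (simp add: u_def power2_eq_square)
    also have "\<dots> \<le> N\<^sup>2"
      using uN u0 by (rule power_mono)
    finally show ?thesis .
  qed
  have strip_b: "69/100 * \<bar>2 * a * b\<bar> \<le> N\<^sup>2"
  proof -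
    have "v\<^sup>2 - 4 * (40/49 * \<bar>a\<bar>) * (3/7 * \<bar>b\<bar>) = (40/49 * \<bar>a\<bar> - 3/7 * \<bar>b\<bar>)\<^sup>2"
      unfolding v_def by algebra
    then have "4 * (40/49 * \<bar>a\<bar>) * (3/7 * \<bar>b\<bar>) \<le> v\<^sup>2"
      by (metis diff_ge_0_iff_ge zero_le_power2)
    moreover have "69/100 * (2 * \<bar>a\<bar> * \<bar>b\<bar>) \<le> 4 * (40/49 * \<bar>a\<bar>) * (3/7 * \<bar>b\<bar>)"
      using mult_nonneg_nonneg[of "\<bar>a\<bar>" "\<bar>b\<bar>"] by simp
    moreover have "v\<^sup>2 \<le> N\<^sup>2"
      using vN v0 by (rule power_mono)
    ultimately show ?thesis
      unfolding prod by linarith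
  qed
  have rhombus: "40/49 * \<bar>a\<^sup>2\<bar> + 3/7 * \<bar>2 * a * b\<bar> \<le> N\<^sup>2"
  proof -
    have "40/49 * \<bar>a\<^sup>2\<bar> + 3/7 * \<bar>2 * a * b\<bar> = 7/5 * (u * v) - 2/5 * u\<^sup>2"
      unfolding sq prod abs_a abs_b by (simp add: power2_eq_square field_simps)
    also have "\<dots> \<le> 7/5 * (u * N) - 2/5 * u\<^sup>2"
      using mult_left_mono[OF vN u0] by simp
    also have "\<dots> = N\<^sup>2 - (N - u) * (N - 2/5 * u)"
      by (simp add: power2_eq_square field_simps)
    also have "\<dots> \<le> N\<^sup>2"
      using uN u0 by simp
    finally show ?thesis .
  qed
  show ?thesis
    using strip_a strip_b rhombus unfolding octagon_gauge_le_iff N_def by blast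
qed

definition dual_number_matrices :: "(real ^ 2 ^ 2) set" where
  "dual_number_matrices = {A. A $ 1 $ 1 = A $ 2 $ 2 \<and> A $ 2 $ 1 = 0}"

definition octagon_norm :: "real ^ 2 ^ 2 \<Rightarrow> real" where
  "octagon_norm A = octagon_gauge (A $ 1 $ 1) (A $ 1 $ 2)"

lemma matrix_mult_2_entry:
  fixes A B :: "real ^ 2 ^ 2"
  shows "(A ** B) $ i $ j = A $ i $ 1 * B $ 1 $ j + A $ i $ 2 * B $ 2 $ j"
  by (simp add: matrix_matrix_mult_def sum_2)

lemma commutative_matrix_algebra_dual_number_matrices:
  "commutative_matrix_algebra dual_number_matrices"
  by (auto simp: commutative_matrix_algebra_def dual_number_matrices_def subspace_def
      matrix_mult_2_entry vec_eq_iff forall_2)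

lemma norm_on_subspace_octagon_norm: "norm_on_subspace dual_number_matrices octagon_norm"
  by (auto simp: norm_on_subspace_def dual_number_matrices_def octagon_norm_def
      octagon_gauge_nonneg octagon_gauge_eq_0_iff octagon_gauge_scale octagon_gauge_triangle
      vec_eq_iff forall_2)

lemma octagon_norm_square_le:
  assumes "A \<in> dual_number_matrices"
  shows "octagon_norm (A ** A) \<le> (octagon_norm A)\<^sup>2"
proof -
  have "(A ** A) $ 1 $ 1 = (A $ 1 $ 1)\<^sup>2" "(A ** A) $ 1 $ 2 = 2 * A $ 1 $ 1 * A $ 1 $ 2"
    using assms by (simp_all add: dual_number_matrices_def matrix_mult_2_entry power2_eq_square)
  then show ?thesis
    using octagon_gauge_square_le by (simp add: octagon_norm_def)
qed

text \<open>The witness is the corner \<open>(p, 1)\<close> of the octagon, at which the squaring condition is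
  sharp.\<close>

lemma octagon_norm_cube_greater:
  "\<exists>A\<in>dual_number_matrices. octagon_norm (A ** A ** A) > (octagon_norm A) ^ 3"
proof
  let ?A = "vector [vector [7/10, 1], vector [0, 7/10]] :: real ^ 2 ^ 2"
  show "?A \<in> dual_number_matrices"
    by (simp add: dual_number_matrices_def)
  show "octagon_norm (?A ** ?A ** ?A) > (octagon_norm ?A) ^ 3"
    by (simp add: octagon_norm_def octagon_gauge_def matrix_mult_2_entry)
qed

theorem theorem0p1:
  shows "\<exists>(\<A> :: (real ^ 2 ^ 2) set) (\<nu> :: real ^ 2 ^ 2 \<Rightarrow> real).
    commutative_matrix_algebra \<A> \<and> norm_on_subspace \<A> \<nu> \<and>
    (\<forall>A\<in>\<A>. \<nu> (A ** A) \<le> (\<nu> A)\<^sup>2) \<and>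
    (\<exists>A\<in>\<A>. \<nu> (A ** A ** A) > (\<nu> A) ^ 3)"
  using commutative_matrix_algebra_dual_number_matrices norm_on_subspace_octagon_norm
    octagon_norm_square_le octagon_norm_cube_greater by blast

end
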